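(* Let $\mathcal L$ be a finite modular complemented lattice. Let $\mathcal Z\subseteq\mathcal L$ be a lattice for the inherited order, with meet $\wedge_{\mathcal Z}$, join $\vee_{\mathcal Z}$ and least element $0_{\mathcal Z}$. Let $\lambda:\mathcal Z\to\mathbb R_{\ge0}$ and $f:\mathcal A(\mathcal L)\to\mathbb R_{\ge0}$. If $(\mathcal Z,\lambda,f)$ satisfies (Z1), (Z2) and (Z5), then $(\mathcal L,\rho_{(\lambda,f)})$ is an $\mathcal L$-polymatroid.
   Context: $\mathcal L$ has least element $\mathbf 0$, greatest element $\mathbf 1$ and height function $\mathrm h$. $\mathcal A(X)$ is the set of atoms below $X$. Complements: $\mathbf C(A)=\{C:C\wedge A=\mathbf 0,C\vee A=\mathbf 1\}$ and $\mathbf C(A;B)=\{A^c\in\mathbf C(A):(A^c\wedge B)\vee(A\wedge B)=B\}$. $\mu_f(\mathbf 0)=0$, and $\mu_f(A)=\min\{\sum_{x\in\beta}f(x):\beta\subseteq\mathcal A(A),|\beta|=\mathrm h(A),\bigvee\beta=A\}$ otherwise. $g$ is quasi-modular on $[\mathbf 0,X]$ if for every $Y\le X$ there is $Y^c\in\mathbf C(Y)$ with $g(X)=g(Y)+g(X\wedge Y^c)$. $\rho_{(\lambda,f)}(X)=\min\{\lambda(Z)+\mu_f(X\wedge Z^c):Z\in\mathcal Z,Z^c\in\mathbf C(Z;X)\}$, and $\mathcal Z(X)$ is the set of $Z$ attaining this minimum for some $Z^c\in\mathbf C(Z;X)$. Axioms: - (Z1) For every $X$ there is $Z\in\mathcal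 Z(X)$ such that (i) $\lambda(Z)+\mu_f(X\wedge Z^c)=\rho_{(\lambda,f)}(X)$ for every $Z^c\in\mathbf C(Z;X)$, and (ii) $\mu_f$ is quasi-modular on $[\mathbf 0,X\wedge Z^c]$ for every $Z^c\in\mathbf C(Z;X)$. - (Z2) For all $Z_1,Z_2\in\mathcal Z$, all $(Z_1\wedge_{\mathcal Z}Z_2)^c\in\mathbf C(Z_1\wedge_{\mathcal Z}Z_2)$ and all $A\in\mathcal L$: $\lambda(Z_1)+\lambda(Z_2)\ge\lambda(Z_1\wedge_{\mathcal Z}Z_2)+\lambda(Z_1\vee_{\mathcal Z}Z_2)+\mu_f(A\wedge Z_1\wedge Z_2\wedge(Z_1\wedge_{\mathcal Z}Z_2)^c)$. - (Z5) $\lambda(0_{\mathcal Z})=0$. An $\mathcal L$-polymatroid is a pair $(\mathcal L,r)$ with $r:\mathcal L\to\mathbb R$ such that, for some $t\ge0$, $0\le r(A)\le t\,\mathrm h(A)$, $r$ is increasing, and $r(A)-r(A\wedge B)\ge r(A\vee B)-r(B)$ for all $A,B$. *)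

theory Defs
  imports "HOL-Library.Lub_Glb"
begin

definition modular_lat :: "'a::lattice itself \<Rightarrow> bool" where
  "modular_lat _ \<longleftrightarrow> (\<forall>x y z::'a. x \<le> z \<longrightarrow> sup x (inf y z) = inf (sup x y) z)"

definition complements :: "'a::bounded_lattice \<Rightarrow> 'a set" where
  "complements A = {C. inf C A = bot \<and> sup C A = top}"

definition complements_rel :: "'a::bounded_lattice \<Rightarrow> 'a \<Rightarrow> 'a set" where
  "complements_rel A B = {Ac \<in> complements A. sup (inf Ac B) (inf A B) = B}"

(* The library class complemented_lattice carries a chosen complement operation;
   here only the existence of complements is required. *)
definition complemented_lat :: "'a::bounded_lattice itself \<Rightarrow> bool" where
  "complemented_lat _ \<longleftrightarrow> (\<forall>x::'a. complements x \<noteq> {})"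

(* Length (number of elements minus one) of a longest chain from bot to A. *)
definition height :: "'a::bounded_lattice \<Rightarrow> nat" where
  "height A = Max {card C - 1 | C.
     Complete_Partial_Order.chain (\<le>) C \<and> C \<subseteq> {bot..A} \<and> bot \<in> C \<and> A \<in> C}"

definition atom :: "'a::bounded_lattice \<Rightarrow> bool" where
  "atom a \<longleftrightarrow> a \<noteq> bot \<and> (\<forall>b. b \<le> a \<longrightarrow> b = bot \<or> b = a)"

definition atoms_below :: "'a::bounded_lattice \<Rightarrow> 'a set" where
  "atoms_below X = {a. atom a \<and> a \<le> X}"

(* For A different from bot the set beta has height A > 0 elements, so Sup_fin is only
   applied to nonempty sets. *)
definition mu :: "('a::bounded_lattice \<Rightarrow> real) \<Rightarrow> 'a \<Rightarrow> real" where
  "mu f A = (if A = bot then 0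
     else Min {(\<Sum>x\<in>\<beta>. f x) | \<beta>. \<beta> \<subseteq> atoms_below A \<and> card \<beta> = height A \<and> Sup_fin \<beta> = A})"

definition quasi_modular :: "('a::bounded_lattice \<Rightarrow> real) \<Rightarrow> 'a \<Rightarrow> bool" where
  "quasi_modular g X \<longleftrightarrow>
     (\<forall>Y. Y \<le> X \<longrightarrow> (\<exists>Yc \<in> complements Y. g X = g Y + g (inf X Yc)))"

(* isGlb R S x and isLub R S x relativise bounds to R, so meets and joins in Z are taken
   for the order inherited by Z and may differ from inf and sup. *)
definition inherited_lattice :: "'a::order set \<Rightarrow> bool" where
  "inherited_lattice Z \<longleftrightarrow> Z \<noteq> {} \<and>
     (\<forall>x\<in>Z. \<forall>y\<in>Z. (\<exists>m. isGlb Z {x, y} m) \<and> (\<exists>j. isLub Z {x, y} j))"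

definition meet_in :: "'a::order set \<Rightarrow> 'a \<Rightarrow> 'a \<Rightarrow> 'a" where
  "meet_in Z x y = (THE m. isGlb Z {x, y} m)"

definition join_in :: "'a::order set \<Rightarrow> 'a \<Rightarrow> 'a \<Rightarrow> 'a" where
  "join_in Z x y = (THE j. isLub Z {x, y} j)"

definition zero_in :: "'a::order set \<Rightarrow> 'a" where
  "zero_in Z = (LEAST z. z \<in> Z)"

definition rho ::
  "'a::bounded_lattice set \<Rightarrow> ('a \<Rightarrow> real) \<Rightarrow> ('a \<Rightarrow> real) \<Rightarrow> 'a \<Rightarrow> real" where
  "rho Z lam f X =
     Min {lam z + mu f (inf X zc) | z zc. z \<in> Z \<and> zc \<in> complements_rel z X}"

definition minimizers ::
  "'a::bounded_lattice set \<Rightarrow> ('a \<Rightarrow> real) \<Rightarrow> ('a \<Rightarrow> real) \<Rightarrow> 'a \<Rightarrow> 'a set" where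
  "minimizers Z lam f X =
     {z \<in> Z. \<exists>zc \<in> complements_rel z X. lam z + mu f (inf X zc) = rho Z lam f X}"

definition axiom_Z1 ::
  "'a::bounded_lattice set \<Rightarrow> ('a \<Rightarrow> real) \<Rightarrow> ('a \<Rightarrow> real) \<Rightarrow> bool" where
  "axiom_Z1 Z lam f \<longleftrightarrow> (\<forall>X. \<exists>z \<in> minimizers Z lam f X.
     (\<forall>zc \<in> complements_rel z X. lam z + mu f (inf X zc) = rho Z lam f X) \<and>
     (\<forall>zc \<in> complements_rel z X. quasi_modular (mu f) (inf X zc)))"

definition axiom_Z2 ::
  "'a::bounded_lattice set \<Rightarrow> ('a \<Rightarrow> real) \<Rightarrow> ('a \<Rightarrow> real) \<Rightarrow> bool" where
  "axiom_Z2 Z lam f \<longleftrightarrow>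
     (\<forall>z1 \<in> Z. \<forall>z2 \<in> Z. \<forall>mc \<in> complements (meet_in Z z1 z2). \<forall>A.
        lam z1 + lam z2 \<ge> lam (meet_in Z z1 z2) + lam (join_in Z z1 z2)
          + mu f (inf (inf (inf A z1) z2) mc))"

definition axiom_Z5 :: "'a::order set \<Rightarrow> ('a \<Rightarrow> real) \<Rightarrow> bool" where
  "axiom_Z5 Z lam \<longleftrightarrow> lam (zero_in Z) = 0"

definition polymatroid :: "('a::bounded_lattice \<Rightarrow> real) \<Rightarrow> bool" where
  "polymatroid r \<longleftrightarrow> (\<exists>t\<ge>0.
     (\<forall>A. 0 \<le> r A \<and> r A \<le> t * real (height A)) \<and>
     mono r \<and>
     (\<forall>A B. r A - r (inf A B) \<ge> r (sup A B) - r B))"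

end

theory Submission
  imports Defs
begin

text \<open>
  In a finite complemented modular lattice the atoms form a matroid with rank function
  \<^const>\<open>height\<close>, and \<^term>\<open>mu f A\<close> is the minimum weight of a basis of \<open>A\<close>.
  The elements \<^term>\<open>inf X zc\<close> with \<^term>\<open>zc \<in> complements_rel z X\<close> are exactly the
  complements of \<^term>\<open>inf X z\<close> in the interval below \<open>X\<close>.

  For monotonicity, a complement of \<^term>\<open>inf X z\<close> below \<open>X \<le> Y\<close> extends to one of
  \<^term>\<open>inf Y z\<close> below \<open>Y\<close>, and quasi-modularity compares their weights.
  For submodularity take the elements \<open>z1\<close>, \<open>z2\<close> that (Z1) provides for \<open>A\<close> and \<open>B\<close>, with meet
  \<open>m\<close> and join \<open>j\<close> in \<open>Z\<close>. A complement of \<open>m\<close> below \<^term>\<open>inf A B\<close> splits as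
  \<open>S \<oplus> T2 \<oplus> T1\<close> along the chain \<open>A \<and> B \<and> m \<le> A \<and> B \<and> z1 \<and> z2 \<le> A \<and> B \<and> z1 \<le> A \<and> B\<close>.
  The weight of \<open>S\<close> is paid for by (Z2); \<open>T1\<close> and \<open>T2\<close> extend to complements of \<open>A \<and> z1\<close> in
  \<open>A\<close> and of \<open>B \<and> z2\<close> in \<open>B\<close>. What quasi-modularity leaves over of these two complements spans
  \<^term>\<open>sup A B\<close> modulo \<open>j\<close>, so its bases contain a basis of a complement of \<open>j\<close>.
\<close>

section \<open>Independent sets of atoms\<close>

text \<open>\<open>atom_ext X \<beta> Y\<close>: the atoms \<open>\<beta>\<close> are independent over \<open>X\<close>, and \<open>Y\<close> is their join
  with \<open>X\<close>.\<close>

inductive atom_ext :: "'a::bounded_lattice \<Rightarrow> 'a set \<Rightarrow> 'a \<Rightarrow> bool" for X where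
  empty: "atom_ext X {} X"
| insert: "atom_ext X \<beta> Y \<Longrightarrow> atom a \<Longrightarrow> \<not> a \<le> Y \<Longrightarrow> atom_ext X (insert a \<beta>) (sup Y a)"

lemma atom_ext_finite: "atom_ext X \<beta> Y \<Longrightarrow> finite \<beta>"
  by (induction rule: atom_ext.induct) auto

lemma atom_ext_atom: "atom_ext X \<beta> Y \<Longrightarrow> a \<in> \<beta> \<Longrightarrow> atom a"
  by (induction rule: atom_ext.induct) auto

lemma atom_ext_base_le: "atom_ext X \<beta> Y \<Longrightarrow> X \<le> Y"
  by (induction rule: atom_ext.induct) (auto intro: le_supI1)

lemma atom_ext_atom_le: "atom_ext X \<beta> Y \<Longrightarrow> a \<in> \<beta> \<Longrightarrow> a \<le> Y"
  by (induction rule: atom_ext.induct) (auto intro: le_supI1)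

lemma atom_ext_least: "atom_ext X \<beta> Y \<Longrightarrow> X \<le> U \<Longrightarrow> (\<And>a. a \<in> \<beta> \<Longrightarrow> a \<le> U) \<Longrightarrow> Y \<le> U"
  by (induction rule: atom_ext.induct) auto

lemma atom_ext_Sup_fin:
  assumes "atom_ext bot \<beta> Y" "\<beta> \<noteq> {}"
  shows "Sup_fin \<beta> = Y"
proof (rule antisym)
  have fin: "finite \<beta>" using assms(1) by (rule atom_ext_finite)
  show "Sup_fin \<beta> \<le> Y"
    using fin assms(2) atom_ext_atom_le[OF assms(1)] by (rule Sup_fin.boundedI)
  show "Y \<le> Sup_fin \<beta>"
    using assms(1) bot_least Sup_fin.coboundedI[OF fin] by (rule atom_ext_least)
qed

lemma atom_ext_trans:
  assumes "atom_ext Y \<gamma> W" "atom_ext X \<beta> Y"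
  shows "atom_ext X (\<beta> \<union> \<gamma>) W"
  using assms by (induction rule: atom_ext.induct) (auto intro: atom_ext.intros)

text \<open>Run through \<beta> and keep an atom only if it is not below the join reached so far.
  This supplies every basis constructed below.\<close>

lemma atom_ext_greedy:
  assumes "finite \<beta>" "\<And>a. a \<in> \<beta> \<Longrightarrow> atom a"
  obtains \<gamma> Y where "\<gamma> \<subseteq> \<beta>" "atom_ext X \<gamma> Y" "\<And>a. a \<in> \<beta> \<Longrightarrow> a \<le> Y"
proof -
  have "\<exists>\<gamma> Y. \<gamma> \<subseteq> \<beta> \<and> atom_ext X \<gamma> Y \<and> (\<forall>a\<in>\<beta>. a \<le> Y)"
    using assms
  proof (induction rule: finite_induct)
    case empty
    then show ?case using atom_ext.empty by blast
  next
    case (insert a \<beta>)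
    then obtain \<gamma> Y where IH: "\<gamma> \<subseteq> \<beta>" "atom_ext X \<gamma> Y" "\<forall>a\<in>\<beta>. a \<le> Y" by blast
    show ?case
    proof (cases "a \<le> Y")
      case True
      then show ?thesis using IH by blast
    next
      case False
      then have "atom_ext X (insert a \<gamma>) (sup Y a)"
        using IH insert.prems by (blast intro: atom_ext.insert)
      moreover have "\<forall>b\<in>insert a \<beta>. b \<le> sup Y a"
        using IH(3) by (auto intro: le_supI1)
      ultimately show ?thesis using IH(1) by (meson insert_mono)
    qed
  qed
  then show ?thesis using that by blast
qed

lemma exists_atom_le:
  fixes X :: "'a::{finite, bounded_lattice}"
  assumes "X \<noteq> bot"
  obtains a where "atom a" "a \<le> X"
proof -
  have "finite {y. y \<le> X \<and> y \<noteq> bot}" "X \<in> {y. y \<le> X \<and> y \<noteq> bot}"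
    using assms by auto
  from finite_has_minimal2[OF this] obtain a
    where a: "a \<le> X" "a \<noteq> bot" "\<And>b. b \<le> X \<and> b \<noteq> bot \<Longrightarrow> b \<le> a \<Longrightarrow> a = b"
    by blast
  then have "atom a"
    unfolding atom_def by (metis order_trans)
  then show ?thesis using that a(1) by blast
qed

lemma inf_atom_eq_bot: "atom a \<Longrightarrow> \<not> a \<le> Y \<Longrightarrow> inf a Y = bot"
  unfolding atom_def by (metis inf.cobounded1 inf.cobounded2)

section \<open>Height as the length of a longest chain\<close>

abbreviation height_chain :: "'a::bounded_lattice \<Rightarrow> 'a set \<Rightarrow> bool" where
  "height_chain A C \<equiv>
     Complete_Partial_Order.chain (\<le>) C \<and> C \<subseteq> {bot..A} \<and> bot \<in> C \<and> A \<in> C"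

lemma height_ge:
  fixes A :: "'a::{finite, bounded_lattice}"
  assumes "height_chain A C"
  shows "card C - 1 \<le> height A"
proof -
  have "finite {card C - 1 | C. height_chain A C}" by (rule finite_image_set) simp
  then show ?thesis
    unfolding height_def using assms by (intro Max_ge) auto
qed

lemma height_attained:
  fixes A :: "'a::{finite, bounded_lattice}"
  obtains C where "height_chain A C" "height A = card C - 1"
proof -
  have fin: "finite {card C - 1 | C. height_chain A C}" by (rule finite_image_set) simp
  have "height_chain A {bot, A}"
    by (auto simp: Complete_Partial_Order.chain_def)
  then have "{card C - 1 | C. height_chain A C} \<noteq> {}" by blast
  then have "height A \<in> {card C - 1 | C. height_chain A C}"
    unfolding height_def using fin by (intro Max_in)
  then show ?thesis using that by blast
qed

lemma height_bot: "height (bot::'a::{finite, bounded_lattice}) = 0"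
proof -
  obtain C where "height_chain (bot::'a) C" "height (bot::'a) = card C - 1"
    by (rule height_attained)
  moreover from this have "C = {bot}" by auto
  ultimately show ?thesis by simp
qed

lemma height_less:
  fixes X :: "'a::{finite, bounded_lattice}"
  assumes "X < Y"
  shows "height X < height Y"
proof -
  obtain C where C: "height_chain X C" "height X = card C - 1"
    by (rule height_attained)
  have "c \<le> Y" if "c \<in> C" for c
    using that C(1) assms by (meson atLeastAtMost_iff less_imp_le order_trans subsetD)
  then have "height_chain Y (insert Y C)"
    using C(1) unfolding Complete_Partial_Order.chain_def by auto
  then have "card (insert Y C) - 1 \<le> height Y" by (rule height_ge)
  moreover have "Y \<notin> C" using C(1) assms by auto
  \<comment> \<open>Since \<open>C\<close> is nonempty, the subtraction in \<open>card C - 1\<close>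
    does not truncate.\<close>
  moreover have "card C > 0" using C(1) by (auto simp: card_gt_0_iff)
  ultimately show ?thesis using C(2) by simp
qed

lemma height_mono: "X \<le> Y \<Longrightarrow> height X \<le> height (Y::'a::{finite, bounded_lattice})"
  using height_less[of X Y] by (cases "X = Y") (auto simp: less_le)

section \<open>Meets, joins and the least element for the inherited order\<close>

lemma meet_in_lower:
  assumes "inherited_lattice Z" "x \<in> Z" "y \<in> Z"
  shows "meet_in Z x y \<in> Z" "meet_in Z x y \<le> x" "meet_in Z x y \<le> y"
proof -
  obtain m where m: "isGlb Z {x, y} m"
    using assms unfolding inherited_lattice_def by blast
  have "meet_in Z x y = m"
    unfolding meet_in_def
  proof (rule the_equality)
    show "isGlb Z {x, y} m" by (rule m)
    fix n assume "isGlb Z {x, y} n"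
    then show "n = m"
      using m unfolding isGlb_def greatestP_def isLb_def setge_def setle_def
      by (auto intro!: antisym)
  qed
  then show "meet_in Z x y \<in> Z" "meet_in Z x y \<le> x" "meet_in Z x y \<le> y"
    using m unfolding isGlb_def greatestP_def isLb_def setge_def by auto
qed

lemma join_in_upper:
  assumes "inherited_lattice Z" "x \<in> Z" "y \<in> Z"
  shows "join_in Z x y \<in> Z" "x \<le> join_in Z x y" "y \<le> join_in Z x y"
proof -
  obtain m where m: "isLub Z {x, y} m"
    using assms unfolding inherited_lattice_def by blast
  have "join_in Z x y = m"
    unfolding join_in_def
  proof (rule the_equality)
    show "isLub Z {x, y} m" by (rule m)
    fix n assume "isLub Z {x, y} n"
    then show "n = m"
      using m unfolding isLub_def leastP_def isUb_def setge_def setle_def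
      by (auto intro!: antisym)
  qed
  then show "join_in Z x y \<in> Z" "x \<le> join_in Z x y" "y \<le> join_in Z x y"
    using m unfolding isLub_def leastP_def isUb_def setle_def by auto
qed

text \<open>Finiteness gives a minimal element of \<open>Z\<close>. Its meet in \<open>Z\<close>
  with any other member lies below it, hence equals it, so it is the least element.\<close>

lemma zero_in_mem:
  fixes Z :: "'a::{finite, order} set"
  assumes "inherited_lattice Z"
  shows "zero_in Z \<in> Z"
proof -
  have "finite Z" "Z \<noteq> {}" using assms unfolding inherited_lattice_def by auto
  from finite_has_minimal[OF this] obtain m
    where m: "m \<in> Z" "\<And>b. b \<in> Z \<Longrightarrow> b \<le> m \<Longrightarrow> m = b" by blast
  have "m \<le> y" if y: "y \<in> Z" for y
  proof -
    obtain g where "isGlb Z {m, y} g"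
      using assms m(1) y unfolding inherited_lattice_def by blast
    then have "g \<in> Z" "g \<le> m" "g \<le> y"
      unfolding isGlb_def greatestP_def isLb_def setge_def by auto
    then show ?thesis using m(2) by blast
  qed
  then have "zero_in Z = m"
    unfolding zero_in_def using m(1) by (intro Least_equality)
  then show ?thesis using m(1) by simp
qed

section \<open>Heights and bases in a modular lattice\<close>

context
  assumes modular: "modular_lat TYPE('a::{finite, bounded_lattice})"
begin

lemma modular_law: "(x::'a) \<le> z \<Longrightarrow> inf (sup x y) z = sup x (inf y z)"
  using modular unfolding modular_lat_def by metis

text \<open>Joining \<open>T\<close> adds nothing below \<open>Q\<close>: by the modular law the
  part of \<open>sup S T\<close> below \<open>Q\<close> is just \<open>S\<close>. With it
  disjointness is propagated upwards along a chain.\<close>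

lemma inf_sup_disjoint:
  fixes S :: 'a
  assumes "inf S M = bot" "S \<le> Q" "M \<le> Q" "inf T Q = bot"
  shows "inf (sup S T) M = bot"
proof -
  have "inf (sup S T) Q = S"
    using modular_law[OF assms(2), of T] assms(4) by simp
  then have "inf (sup S T) M \<le> inf S M"
    using assms(3) by (metis inf.absorb_iff2 inf.assoc order_refl)
  then show ?thesis using assms(1) by (simp add: bot_unique)
qed

text \<open>Cut a longest chain below \<open>sup X a\<close> into the part \<open>C1\<close> below
  \<open>X\<close> and the rest \<open>C2\<close>, and push \<open>C2\<close> below \<open>X\<close>
  by meeting with \<open>X\<close>. The result is a chain below \<open>X\<close> with at most one
  element fewer.\<close>

lemma height_sup_atom_le:
  fixes X :: 'a
  assumes a: "atom a" and nle: "\<not> a \<le> X"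
  shows "height (sup X a) \<le> Suc (height X)"
proof -
  let ?Y = "sup X a"
  \<comment> \<open>Nothing lies strictly between \<open>X\<close> and \<open>sup X a\<close>:
    modularity writes \<open>sup X c\<close> as the join of \<open>X\<close> with a part of
    \<open>a\<close>, and that part is \<open>a\<close> or \<open>bot\<close>.\<close>
  have cover: "sup X c = ?Y" if "c \<le> ?Y" "\<not> c \<le> X" for c
  proof -
    have eq: "sup X (inf a (sup X c)) = sup X c"
      using modular_law[of X "sup X c" a] that(1) by (simp add: inf.absorb2 le_supI2)
    show ?thesis
    proof (cases "a \<le> sup X c")
      case True
      then show ?thesis using eq by (simp add: inf.absorb1)
    next
      case False
      then have "sup X c = X" using eq inf_atom_eq_bot[OF a] by simp
      then show ?thesis using that(2) by (metis sup.cobounded2)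
    qed
  qed
  obtain C where C: "height_chain ?Y C" "height ?Y = card C - 1"
    by (rule height_attained)
  have chain: "c \<le> d \<or> d \<le> c" if "c \<in> C" "d \<in> C" for c d
    using C(1) that unfolding Complete_Partial_Order.chain_def by blast
  define C1 where "C1 = {c \<in> C. c \<le> X}"
  define C2 where "C2 = {c \<in> C. \<not> c \<le> X}"
  define D where "D = inf X ` C2"
  have inj: "inj_on (inf X) C2"
  proof -
    \<comment> \<open>Comparable elements with the same meet and the same join with \<open>X\<close>
      coincide, by the modular law.\<close>
    have "c = d" if "c \<le> d" "c \<in> C2" "d \<in> C2" "inf X c = inf X d" for c d
    proof -
      have "sup X c = ?Y" "d \<le> ?Y" using cover that C(1) by (auto simp: C2_def)
      then have "d = inf (sup c X) d" by (simp add: inf.absorb2 sup.commute)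
      also have "\<dots> = sup c (inf X d)" using that(1) by (rule modular_law)
      also have "\<dots> = c" using that(4) by (metis inf.cobounded2 sup.absorb1)
      finally show ?thesis ..
    qed
    then show ?thesis
      unfolding inj_on_def by (metis (mono_tags, lifting) C2_def chain mem_Collect_eq)
  qed
  have le: "c \<le> d" if c: "c \<in> C1" and d: "d \<in> D" for c d
  proof -
    obtain e where e: "e \<in> C" "\<not> e \<le> X" "d = inf X e"
      using d by (auto simp: D_def C2_def)
    then have "c \<le> e" using chain[of c e] c by (auto simp: C1_def intro: order_trans)
    then show ?thesis using c e(3) by (simp add: C1_def)
  qed
  have "Complete_Partial_Order.chain (\<le>) (C1 \<union> D)"
    unfolding Complete_Partial_Order.chain_def
  proof (intro ballI)
    fix c d assume cd: "c \<in> C1 \<union> D" "d \<in> C1 \<union> D"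
    have "c \<le> d \<or> d \<le> c" if "c \<in> D" "d \<in> D"
      using that chain unfolding D_def C2_def by (auto intro: le_infI2)
         (meson inf.cobounded1 inf_mono inf.cobounded2 le_infI2 order_refl)+
    moreover have "c \<le> d \<or> d \<le> c" if "c \<in> C1" "d \<in> C1"
      using that chain unfolding C1_def by blast
    ultimately show "c \<le> d \<or> d \<le> c" using cd le by blast
  qed
  moreover have "?Y \<in> C2" "bot \<in> C1"
    using C(1) nle by (auto simp: C1_def C2_def)
  then have "X \<in> D" "bot \<in> C1 \<union> D"
    unfolding D_def by (auto intro!: image_eqI[of _ _ ?Y])
  moreover have "C1 \<union> D \<subseteq> {bot..X}" by (auto simp: C1_def D_def)
  ultimately have "card (C1 \<union> D) - 1 \<le> height X"
    by (intro height_ge) auto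
  moreover have "card C \<le> Suc (card (C1 \<union> D))"
  proof -
    have "C = C1 \<union> C2" "C1 \<inter> C2 = {}" by (auto simp: C1_def C2_def)
    then have "card C = card C1 + card D"
      using card_image[OF inj] by (simp add: D_def card_Un_disjoint)
    also have "\<dots> = card (C1 \<union> D) + card (C1 \<inter> D)"
      by (rule card_Un_Int) auto
    \<comment> \<open>Everything in \<open>C1\<close> lies below everything in \<open>D\<close>, so
      two common elements lie below each other.\<close>
    also have "card (C1 \<inter> D) \<le> 1"
      using le by (auto simp: card_le_Suc0_iff_eq intro!: antisym)
    finally show ?thesis by simp
  qed
  moreover have "card (C1 \<union> D) > 0" using \<open>X \<in> D\<close> by (auto simp: card_gt_0_iff)
  ultimately show ?thesis using C(2) by linarith
qed

lemma height_sup_atom: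
  fixes X :: 'a
  assumes "atom a" "\<not> a \<le> X"
  shows "height (sup X a) = Suc (height X)"
proof -
  have "X < sup X a" using assms(2) by (metis le_iff_sup sup.cobounded1 sup.commute less_le)
  then show ?thesis
    using height_less height_sup_atom_le[OF assms] by (metis le_antisym Suc_leI)
qed

lemma atom_ext_height: "atom_ext (X::'a) \<beta> Y \<Longrightarrow> height Y = height X + card \<beta>"
proof (induction rule: atom_ext.induct)
  case (insert \<beta> Y a)
  then have "a \<notin> \<beta>" using atom_ext_atom_le by blast
  then show ?case
    using insert height_sup_atom atom_ext_finite[OF insert.hyps(1)] by simp
qed simp

text \<open>This matches independence with the sets in the definition of \<open>mu\<close>. For the
  converse, a greedy independent subset of \<beta> already spans \<open>A\<close>, so it has
  \<open>height A\<close> elements and is all of \<beta>.\<close>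

lemma atom_ext_bot_iff:
  fixes A :: 'a
  assumes "A \<noteq> bot"
  shows "atom_ext bot \<beta> A \<longleftrightarrow> \<beta> \<subseteq> atoms_below A \<and> card \<beta> = height A \<and> Sup_fin \<beta> = A"
proof
  assume ext: "atom_ext bot \<beta> A"
  then have "card \<beta> = height A" using atom_ext_height height_bot by fastforce
  moreover have "\<beta> \<noteq> {}"
    using ext assms by (auto elim: atom_ext.cases)
  ultimately show "\<beta> \<subseteq> atoms_below A \<and> card \<beta> = height A \<and> Sup_fin \<beta> = A"
    using ext atom_ext_Sup_fin atom_ext_atom atom_ext_atom_le
    by (auto simp: atoms_below_def)
next
  assume \<beta>: "\<beta> \<subseteq> atoms_below A \<and> card \<beta> = height A \<and> Sup_fin \<beta> = A"
  have "\<And>a. a \<in> \<beta> \<Longrightarrow> atom a" using \<beta> by (auto simp: atoms_below_def)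
  with finite[of \<beta>] obtain \<gamma> Y
    where \<gamma>: "\<gamma> \<subseteq> \<beta>" "atom_ext bot \<gamma> Y" "\<And>a. a \<in> \<beta> \<Longrightarrow> a \<le> Y"
    by (rule atom_ext_greedy[of \<beta> bot]) blast+
  \<comment> \<open>\<open>Sup_fin\<close> is a genuine join only on nonempty sets.\<close>
  have "height A \<noteq> 0"
    using height_less[of bot A] assms by (simp add: bot.not_eq_extremum)
  then have "\<beta> \<noteq> {}" using \<beta> by auto
  then have "A \<le> Y" using \<beta> \<gamma>(3) Sup_fin.boundedI[of \<beta> Y] by auto
  moreover have "Y \<le> A"
    using \<gamma>(1,2) \<beta> by (auto elim!: atom_ext_least simp: atoms_below_def)
  ultimately have "Y = A" by simp
  then have "card \<gamma> = card \<beta>"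
    using atom_ext_height[OF \<gamma>(2)] \<beta> by (simp add: height_bot)
  then have "\<gamma> = \<beta>" using \<gamma>(1) by (simp add: card_subset_eq)
  then show "atom_ext bot \<beta> A" using \<gamma>(2) \<open>Y = A\<close> by simp
qed

text \<open>The case distinction at \<open>bot\<close> disappears, because the empty set is the only
  basis of \<open>bot\<close> and has weight 0.\<close>

lemma mu_eq: "mu f (A::'a) = Min {sum f \<beta> | \<beta>. atom_ext bot \<beta> A}"
proof (cases "A = bot")
  case True
  have "\<beta> = {}" if "atom_ext bot \<beta> (bot::'a)" for \<beta>
    using atom_ext_height[OF that] by simp
  then have "{sum f \<beta> | \<beta>. atom_ext bot \<beta> (bot::'a)} = {0}"
    using atom_ext.empty[of "bot::'a"] by force
  then show ?thesis using True by (simp add: mu_def)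
next
  case False
  then show ?thesis by (simp add: mu_def atom_ext_bot_iff)
qed

lemma finite_basis_weights: "finite {sum f \<beta> | \<beta>. atom_ext (X::'a) \<beta> A}"
  by (rule finite_subset[of _ "sum f ` UNIV"]) auto

lemma mu_le: "atom_ext bot \<beta> (A::'a) \<Longrightarrow> mu f A \<le> sum f \<beta>"
  unfolding mu_eq using finite_basis_weights by (intro Min_le) auto

lemma atom_ext_disjoint:
  fixes S :: 'a
  assumes "atom_ext bot \<beta> T" "inf S T = bot"
  shows "atom_ext S \<beta> (sup S T)"
  using assms
proof (induction rule: atom_ext.induct)
  case empty
  then show ?case using atom_ext.empty by simp
next
  case (insert \<beta> Y a)
  have "inf S Y \<le> inf S (sup Y a)" by (simp add: le_infI2)
  then have "inf S Y = bot" using insert.prems by (simp add: bot_unique)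
  then have IH: "atom_ext S \<beta> (sup S Y)" by (rule insert.IH)
  have "\<not> a \<le> sup S Y"
  proof
    assume "a \<le> sup S Y"
    \<comment> \<open>An atom below both joins lies, by the modular law, below \<open>Y\<close>
      joined with the part of \<open>S\<close> in \<open>sup Y a\<close>, and that part is
      \<open>bot\<close>.\<close>
    then have "a \<le> inf (sup Y S) (sup Y a)" by (simp add: sup.commute)
    also have "\<dots> = Y" using insert.prems by (simp add: modular_law)
    finally show False using insert.hyps by simp
  qed
  from atom_ext.insert[OF IH insert.hyps(2) this] show ?case by (simp add: sup.assoc)
qed

text \<open>\<open>V\<close> is the join of \<gamma> alone, built up from \<open>bot\<close> instead
  of \<open>X\<close>. Thus \<gamma> becomes a basis of a complement of \<open>X\<close> below
  \<open>Y\<close> and bounds its weight.\<close>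

lemma atom_ext_complement:
  fixes X :: 'a
  assumes "atom_ext X \<gamma> Y"
  obtains V where "atom_ext bot \<gamma> V" "inf V X = bot" "sup V X = Y"
proof -
  have "\<exists>V. atom_ext bot \<gamma> V \<and> inf V X = bot \<and> sup V X = Y"
    using assms
  proof (induction rule: atom_ext.induct)
    case empty
    then show ?case using atom_ext.empty by (intro exI[of _ bot]) simp
  next
    case (insert \<beta> Y a)
    then obtain V where V: "atom_ext bot \<beta> V" "inf V X = bot" "sup V X = Y" by blast
    have "inf (sup V a) X = bot"
      by (rule inf_sup_disjoint[OF V(2), of Y]) (use V(3) insert.hyps in \<open>auto simp: inf_atom_eq_bot\<close>)
    moreover have "\<not> a \<le> V" using insert.hyps V(3) le_supI1 by blast
    then have "atom_ext bot (insert a \<beta>) (sup V a)"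
      using V(1) insert.hyps by (blast intro: atom_ext.insert)
    moreover have "sup (sup V a) X = sup Y a" using V(3) by (metis sup.assoc sup.commute)
    ultimately show ?case by blast
  qed
  then show ?thesis using that by blast
qed

section \<open>Relative complements\<close>

context
  assumes complemented: "complemented_lat TYPE('a)"
begin

text \<open>Cut a complement of \<open>sup W Q\<close> in the whole lattice down to \<open>Y\<close>
  and join it to \<open>W\<close>.\<close>

lemma exists_complement_above:
  fixes W :: 'a
  assumes "inf W Q = bot" "W \<le> Y" "Q \<le> Y"
  obtains V where "W \<le> V" "inf V Q = bot" "sup V Q = Y"
proof -
  obtain T where T: "inf T (sup W Q) = bot" "sup T (sup W Q) = top"
    using complemented unfolding complemented_lat_def complements_def by blast
  let ?V = "sup W (inf T Y)"
  have "inf ?V Q = bot"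
  proof (rule inf_sup_disjoint[OF assms(1), of "sup W Q"])
    show "inf (inf T Y) (sup W Q) = bot"
      using T(1) by (metis inf.assoc inf.commute inf_bot_right)
  qed auto
  moreover have "sup ?V Q = sup (sup W Q) (inf T Y)" by (simp add: ac_simps)
  then have "sup ?V Q = Y"
    using modular_law[of "sup W Q" Y T] T(2) assms by (simp add: sup.commute)
  ultimately show ?thesis using that[of ?V] by simp
qed

lemma exists_complement_in:
  fixes Q :: 'a
  assumes "Q \<le> Y"
  obtains V where "inf V Q = bot" "sup V Q = Y"
  using exists_complement_above[of bot Q Y] assms by auto

text \<open>Only \<open>inf X zc\<close> enters \<open>rho\<close>, so this lets \<open>zc\<close>
  be eliminated. For the converse, \<open>W\<close> is enlarged to a complement of \<open>z\<close>
  in the whole lattice, and the modular law shows that this adds nothing below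
  \<open>X\<close>.\<close>

lemma ex_complements_rel_iff:
  fixes X :: 'a
  shows "(\<exists>zc \<in> complements_rel z X. inf X zc = W) \<longleftrightarrow> inf W z = bot \<and> sup W (inf X z) = X"
proof
  assume "\<exists>zc \<in> complements_rel z X. inf X zc = W"
  then obtain zc where zc: "inf zc z = bot" "sup (inf zc X) (inf z X) = X" "inf X zc = W"
    unfolding complements_rel_def complements_def by blast
  then have "inf W z = bot" by (metis inf.assoc inf_bot_right)
  then show "inf W z = bot \<and> sup W (inf X z) = X"
    using zc by (simp add: inf.commute)
next
  assume W: "inf W z = bot \<and> sup W (inf X z) = X"
  then obtain zc where zc: "W \<le> zc" "inf zc z = bot" "sup zc z = top"
    using exists_complement_above[of W z top] by auto
  have "inf X zc = sup W (inf (inf X z) zc)"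
    using modular_law[OF zc(1)] W by metis
  also have "inf (inf X z) zc = bot" using zc(2) by (simp add: ac_simps)
  finally have "inf X zc = W" by simp
  moreover from this have "zc \<in> complements_rel z X"
    using zc W unfolding complements_rel_def complements_def by (simp add: inf.commute)
  ultimately show "\<exists>zc \<in> complements_rel z X. inf X zc = W" by blast
qed

text \<open>Run the greedy choice over all atoms below \<open>A\<close>. A complement of the
  resulting join in \<open>A\<close> contains no atom, so it is \<open>bot\<close>.\<close>

lemma exists_basis:
  fixes A :: 'a
  obtains \<beta> where "atom_ext bot \<beta> A"
proof -
  have "\<And>a. a \<in> atoms_below A \<Longrightarrow> atom a" by (auto simp: atoms_below_def)
  then obtain \<gamma> Y
    where \<gamma>: "\<gamma> \<subseteq> atoms_below A" "atom_ext bot \<gamma> Y" "\<And>a. a \<in> atoms_below A \<Longrightarrow> a \<le> Y"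
    by (rule atom_ext_greedy[of "atoms_below A" bot, OF finite]) blast+
  have "Y \<le> A"
    using \<gamma>(1,2) by (auto elim!: atom_ext_least simp: atoms_below_def)
  then obtain V where V: "inf V Y = bot" "sup V Y = A" by (rule exists_complement_in)
  have "V = bot"
  proof (rule ccontr)
    assume "V \<noteq> bot"
    then obtain a where a: "atom a" "a \<le> V" by (rule exists_atom_le)
    then have "a \<le> A" using V(2) by (metis le_supI1)
    then have "a \<le> Y" using \<gamma>(3) a by (simp add: atoms_below_def)
    then have "a \<le> bot" using a(2) V(1) by (metis inf_greatest)
    then show False using a(1) by (simp add: atom_def bot_unique)
  qed
  then show ?thesis using that \<gamma>(2) V(2) by simp
qed

lemma mu_attained:
  fixes A :: 'a
  obtains \<beta> where "atom_ext bot \<beta> A" "mu f A = sum f \<beta>"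
proof -
  have "{sum f \<beta> | \<beta>. atom_ext bot \<beta> A} \<noteq> {}" using exists_basis by blast
  then have "mu f A \<in> {sum f \<beta> | \<beta>. atom_ext bot \<beta> A}"
    unfolding mu_eq using finite_basis_weights by (intro Min_in)
  then show ?thesis using that by blast
qed

section \<open>Minimum-weight bases for nonnegative weights\<close>

context
  fixes f :: "'a \<Rightarrow> real"
  assumes f_nonneg: "\<And>a. atom a \<Longrightarrow> 0 \<le> f a"
begin

lemma mu_nonneg: "0 \<le> mu f A"
proof -
  obtain \<beta> where "atom_ext bot \<beta> A" "mu f A = sum f \<beta>" by (rule mu_attained)
  then show ?thesis using f_nonneg atom_ext_atom by (metis sum_nonneg)
qed

text \<open>The maximum runs over the whole lattice, where \<open>f\<close> is arbitrary off the
  atoms; the absolute value keeps the constant nonnegative.\<close>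

lemma mu_le_height: "mu f A \<le> (MAX a. \<bar>f a\<bar>) * real (height A)"
proof -
  obtain \<beta> where \<beta>: "atom_ext bot \<beta> A" "mu f A = sum f \<beta>" by (rule mu_attained)
  have "f a \<le> (MAX a. \<bar>f a\<bar>)" for a
    by (rule order_trans[OF abs_ge_self]) (rule Max_ge; simp)
  then have "sum f \<beta> \<le> real (card \<beta>) * (MAX a. \<bar>f a\<bar>)" by (intro sum_bounded_above)
  also have "card \<beta> = height A" using atom_ext_height[OF \<beta>(1)] by (simp add: height_bot)
  finally show ?thesis using \<beta>(2) by (simp add: mult.commute)
qed

text \<open>Disjointness makes the union of minimum-weight bases of \<open>S\<close> and
  \<open>T\<close> a basis of the join.\<close>

lemma mu_sup_le:
  assumes "inf S T = bot"
  shows "mu f (sup S T) \<le> mu f S + mu f T"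
proof -
  obtain \<beta> where \<beta>: "atom_ext bot \<beta> S" "mu f S = sum f \<beta>" by (rule mu_attained)
  obtain \<gamma> where \<gamma>: "atom_ext bot \<gamma> T" "mu f T = sum f \<gamma>" by (rule mu_attained)
  have "mu f (sup S T) \<le> sum f (\<beta> \<union> \<gamma>)"
    using atom_ext_trans[OF atom_ext_disjoint[OF \<gamma>(1) assms] \<beta>(1)] by (rule mu_le)
  also have "\<dots> \<le> sum f \<beta> + sum f \<gamma>"
    using f_nonneg atom_ext_atom[OF \<beta>(1)] by (auto simp: sum_Un intro!: sum_nonneg)
  finally show ?thesis using \<beta> \<gamma> by simp
qed

text \<open>Minimum-weight bases of \<open>A\<close> and \<open>B\<close> together span
  \<open>Y\<close> over \<open>Q\<close>. A greedy subset independent over \<open>Q\<close> is a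
  basis of a complement of \<open>Q\<close>, and dropping atoms cannot raise the weight.\<close>

lemma exists_complement_mu_le:
  assumes "sup Q (sup A B) = Y"
  obtains V where "inf V Q = bot" "sup V Q = Y" "mu f V \<le> mu f A + mu f B"
proof -
  obtain \<alpha> where \<alpha>: "atom_ext bot \<alpha> A" "mu f A = sum f \<alpha>" by (rule mu_attained)
  obtain \<beta> where \<beta>: "atom_ext bot \<beta> B" "mu f B = sum f \<beta>" by (rule mu_attained)
  have atoms: "\<And>a. a \<in> \<alpha> \<union> \<beta> \<Longrightarrow> atom a" using \<alpha> \<beta> atom_ext_atom by blast
  then obtain \<gamma> Y' where \<gamma>: "\<gamma> \<subseteq> \<alpha> \<union> \<beta>" "atom_ext Q \<gamma> Y'" "\<And>a. a \<in> \<alpha> \<union> \<beta> \<Longrightarrow> a \<le> Y'"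
    by (rule atom_ext_greedy[of "\<alpha> \<union> \<beta>" Q, OF finite]) blast+
  have "A \<le> Y'" "B \<le> Y'" using \<alpha>(1) \<beta>(1) \<gamma>(3) by (auto elim!: atom_ext_least)
  then have "Y \<le> Y'" using assms atom_ext_base_le[OF \<gamma>(2)] by auto
  moreover have "a \<le> Y" if "a \<in> \<alpha> \<union> \<beta>" for a
    using that assms atom_ext_atom_le[OF \<alpha>(1)] atom_ext_atom_le[OF \<beta>(1)]
    by (auto intro: le_supI1 le_supI2)
  then have "Y' \<le> Y"
    using \<gamma>(1) assms by (intro atom_ext_least[OF \<gamma>(2)]) auto
  ultimately have "Y' = Y" by simp
  then obtain V where V: "atom_ext bot \<gamma> V" "inf V Q = bot" "sup V Q = Y"
    using atom_ext_complement[OF \<gamma>(2)] by blast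
  have "mu f V \<le> sum f \<gamma>" using V(1) by (rule mu_le)
  also have "\<dots> \<le> sum f (\<alpha> \<union> \<beta>)"
    using \<gamma>(1) atoms f_nonneg by (intro sum_mono2) auto
  also have "\<dots> \<le> sum f \<alpha> + sum f \<beta>"
    using f_nonneg atoms by (auto simp: sum_Un intro!: sum_nonneg)
  finally show ?thesis using that V \<alpha> \<beta> by simp
qed

lemma quasi_modular_split:
  assumes "quasi_modular (mu f) X" "Y \<le> X"
  obtains W where "sup Y W = X" "mu f X = mu f Y + mu f W"
proof -
  obtain Yc where Yc: "sup Yc Y = top" "mu f X = mu f Y + mu f (inf X Yc)"
    using assms unfolding quasi_modular_def complements_def by blast
  have "sup Y (inf X Yc) = X"
    using modular_law[OF assms(2), of Yc] Yc(1) by (simp add: ac_simps)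
  then show ?thesis using that Yc(2) by blast
qed

section \<open>Bounds for \<open>rho\<close>\<close>

context
  fixes Z :: "'a set" and lam :: "'a \<Rightarrow> real"
  assumes lattice_Z: "inherited_lattice Z"
    and lam_nonneg: "\<And>z. z \<in> Z \<Longrightarrow> 0 \<le> lam z"
begin

lemma rho_eq:
  "rho Z lam f X = Min {lam z + mu f W | z W. z \<in> Z \<and> inf W z = bot \<and> sup W (inf X z) = X}"
proof -
  have "{lam z + mu f (inf X zc) | z zc. z \<in> Z \<and> zc \<in> complements_rel z X}
      = {lam z + mu f W | z W. z \<in> Z \<and> (\<exists>zc \<in> complements_rel z X. inf X zc = W)}"
    by blast
  then show ?thesis unfolding rho_def ex_complements_rel_iff by simp
qed

lemma finite_rho_values:
  "finite {lam z + mu f W | z W. z \<in> Z \<and> inf W z = bot \<and> sup W (inf X z) = X}"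
  by (rule finite_subset[of _ "(\<lambda>(z, W). lam z + mu f W) ` UNIV"]) auto

lemma rho_le:
  "z \<in> Z \<Longrightarrow> inf W z = bot \<Longrightarrow> sup W (inf X z) = X \<Longrightarrow> rho Z lam f X \<le> lam z + mu f W"
  unfolding rho_eq using finite_rho_values by (intro Min_le) auto

lemma rho_nonneg: "0 \<le> rho Z lam f X"
proof -
  obtain z where z: "z \<in> Z" using lattice_Z unfolding inherited_lattice_def by blast
  obtain W where W: "inf W (inf X z) = bot" "sup W (inf X z) = X"
    by (rule exists_complement_in[of "inf X z" X]) auto
  \<comment> \<open>As \<open>W\<close> is below \<open>X\<close>, its meet with \<open>z\<close> is
    its meet with \<open>inf X z\<close>.\<close>
  have "inf W z = bot"
    using W by (metis inf.absorb1 inf.assoc sup.cobounded1)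
  then have "{lam z + mu f W | z W. z \<in> Z \<and> inf W z = bot \<and> sup W (inf X z) = X} \<noteq> {}"
    using z W by blast
  then have "rho Z lam f X \<in> {lam z + mu f W | z W. z \<in> Z \<and> inf W z = bot \<and> sup W (inf X z) = X}"
    unfolding rho_eq using finite_rho_values by (intro Min_in)
  then show ?thesis using lam_nonneg mu_nonneg by auto
qed

lemma rho_le_height:
  assumes "axiom_Z5 Z lam"
  shows "rho Z lam f X \<le> (MAX a. \<bar>f a\<bar>) * real (height X)"
proof -
  let ?z = "zero_in Z"
  have z: "?z \<in> Z" using lattice_Z by (rule zero_in_mem)
  obtain W where W: "inf W (inf X ?z) = bot" "sup W (inf X ?z) = X"
    by (rule exists_complement_in[of "inf X ?z" X]) auto
  have "W \<le> X" using W(2) by (metis sup.cobounded1)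
  have "inf W ?z = bot"
    using W by (metis inf.absorb1 inf.assoc sup.cobounded1)
  then have "rho Z lam f X \<le> mu f W"
    using rho_le[OF z _ W(2)] assms unfolding axiom_Z5_def by simp
  also have "\<dots> \<le> (MAX a. \<bar>f a\<bar>) * real (height W)" by (rule mu_le_height)
  also have "\<dots> \<le> (MAX a. \<bar>f a\<bar>) * real (height X)"
  proof (rule mult_left_mono)
    show "real (height W) \<le> real (height X)" using \<open>W \<le> X\<close> height_mono by simp
    have "\<bar>f bot\<bar> \<le> (MAX a. \<bar>f a\<bar>)" by (rule Max_ge) auto
    then show "0 \<le> (MAX a. \<bar>f a\<bar>)" by linarith
  qed
  finally show ?thesis .
qed

section \<open>Monotonicity and submodularity of \<open>rho\<close>\<close>

context
  assumes Z1: "axiom_Z1 Z lam f"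
begin

text \<open>Since (Z1) allows every complement, the one attaining the minimum can be chosen above
  any given \<open>W\<close> that is disjoint from \<open>z\<close>.\<close>

lemma rho_attained:
  obtains z where "z \<in> Z"
    "\<And>W. inf W z = bot \<Longrightarrow> W \<le> X \<Longrightarrow> \<exists>V. W \<le> V \<and> sup V (inf X z) = X \<and>
       rho Z lam f X = lam z + mu f V \<and> quasi_modular (mu f) V"
proof -
  obtain z where z: "z \<in> Z"
    "\<And>zc. zc \<in> complements_rel z X \<Longrightarrow>
       lam z + mu f (inf X zc) = rho Z lam f X \<and> quasi_modular (mu f) (inf X zc)"
    using Z1 unfolding axiom_Z1_def minimizers_def by blast
  show ?thesis
  proof (rule that[OF z(1)])
    fix W assume W: "inf W z = bot" "W \<le> X"
    then have "inf W (inf X z) = bot" by (metis inf.left_commute inf_bot_right)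
    then obtain V where V: "W \<le> V" "inf V (inf X z) = bot" "sup V (inf X z) = X"
      using W(2) by (rule exists_complement_above[of W "inf X z" X]) auto
    have "inf V z = bot"
      using V by (metis inf.absorb1 inf.assoc sup.cobounded1)
    then obtain zc where "zc \<in> complements_rel z X" "inf X zc = V"
      using V(3) ex_complements_rel_iff by metis
    then show "\<exists>V. W \<le> V \<and> sup V (inf X z) = X \<and>
       rho Z lam f X = lam z + mu f V \<and> quasi_modular (mu f) V"
      using z(2) V by metis
  qed
qed

lemma rho_mono: "X \<le> Y \<Longrightarrow> rho Z lam f X \<le> rho Z lam f Y"
proof -
  assume XY: "X \<le> Y"
  obtain z where z: "z \<in> Z"
    "\<And>W. inf W z = bot \<Longrightarrow> W \<le> Y \<Longrightarrow> \<exists>V. W \<le> V \<and> sup V (inf Y z) = Y \<and>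
       rho Z lam f Y = lam z + mu f V \<and> quasi_modular (mu f) V"
    using rho_attained[of Y] by blast
  obtain W where W: "inf W (inf X z) = bot" "sup W (inf X z) = X"
    by (rule exists_complement_in[of "inf X z" X]) auto
  have Wz: "inf W z = bot" and "W \<le> X"
    using W by (metis inf.absorb1 inf.assoc sup.cobounded1, metis sup.cobounded1)
  then obtain V where V: "W \<le> V" "rho Z lam f Y = lam z + mu f V" "quasi_modular (mu f) V"
    using z(2)[of W] XY by (meson order_trans)
  \<comment> \<open>For general weights \<open>mu f\<close> is not monotone; the comparison of
    \<open>W\<close> with \<open>V\<close> rests on quasi-modularity below \<open>V\<close>.\<close>
  obtain U where "mu f V = mu f W + mu f U"
    using quasi_modular_split[OF V(3,1)] by blast
  then have "mu f W \<le> mu f V" using mu_nonneg[of U] by simp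
  then show ?thesis using rho_le[OF z(1) Wz W(2)] V(2) by simp
qed

lemma rho_submodular:
  assumes Z2: "axiom_Z2 Z lam f"
  shows "rho Z lam f (inf A B) + rho Z lam f (sup A B) \<le> rho Z lam f A + rho Z lam f B"
proof -
  obtain z1 where z1: "z1 \<in> Z"
    "\<And>W. inf W z1 = bot \<Longrightarrow> W \<le> A \<Longrightarrow> \<exists>V. W \<le> V \<and> sup V (inf A z1) = A \<and>
       rho Z lam f A = lam z1 + mu f V \<and> quasi_modular (mu f) V"
    using rho_attained[of A] by blast
  obtain z2 where z2: "z2 \<in> Z"
    "\<And>W. inf W z2 = bot \<Longrightarrow> W \<le> B \<Longrightarrow> \<exists>V. W \<le> V \<and> sup V (inf B z2) = B \<and>
       rho Z lam f B = lam z2 + mu f V \<and> quasi_modular (mu f) V"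
    using rho_attained[of B] by blast
  define m where "m = meet_in Z z1 z2"
  define j where "j = join_in Z z1 z2"
  have m: "m \<in> Z" "m \<le> z1" "m \<le> z2"
    unfolding m_def using meet_in_lower[OF lattice_Z z1(1) z2(1)] by auto
  have j: "j \<in> Z" "z1 \<le> j" "z2 \<le> j"
    unfolding j_def using join_in_upper[OF lattice_Z z1(1) z2(1)] by auto
  define P where "P = inf (inf A B) z1"
  define Q where "Q = inf P z2"
  define R where "R = inf (inf A B) m"
  have le: "R \<le> Q" "Q \<le> P" "P \<le> inf A B"
    using m unfolding P_def Q_def R_def by (auto intro: le_infI2 le_infI1)
  obtain T1 where T1: "inf T1 P = bot" "sup T1 P = inf A B"
    using exists_complement_in[OF le(3)] .
  obtain T2 where T2: "inf T2 Q = bot" "sup T2 Q = P"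
    using exists_complement_in[OF le(2)] .
  obtain S where S: "inf S R = bot" "sup S R = Q"
    using exists_complement_in[OF le(1)] .
  have T1_le: "T1 \<le> A" "T1 \<le> B" using T1(2) by (metis le_infE sup.cobounded1)+
  have "T2 \<le> P" using T2(2) by (metis sup.cobounded1)
  then have T2_le: "T2 \<le> A" "T2 \<le> B" "T2 \<le> z1" by (auto simp: P_def)
  have "S \<le> Q" using S(2) by (metis sup.cobounded1)
  then have S_le: "S \<le> A" "S \<le> B" "S \<le> z1" "S \<le> z2" by (auto simp: P_def Q_def)
  \<comment> \<open>As \<open>T1\<close> is below \<open>inf A B\<close>, it is disjoint from
    \<open>z1\<close> and extends to an optimal complement \<open>A'\<close>; likewise
    \<open>T2\<close> with \<open>z2\<close> and \<open>B'\<close>.\<close>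
  have "inf T1 z1 = inf T1 P"
    using T1_le by (simp add: P_def inf.absorb1 flip: inf.assoc)
  with T1(1) T1_le z1(2)[of T1] obtain A' where A':
    "T1 \<le> A'" "sup A' (inf A z1) = A" "rho Z lam f A = lam z1 + mu f A'" "quasi_modular (mu f) A'"
    by auto
  have "inf T2 z2 = inf T2 Q"
    using T2_le by (simp add: P_def Q_def inf.absorb1 flip: inf.assoc)
  with T2(1) T2_le z2(2)[of T2] obtain B' where B':
    "T2 \<le> B'" "sup B' (inf B z2) = B" "rho Z lam f B = lam z2 + mu f B'" "quasi_modular (mu f) B'"
    by auto
  obtain A'' where A'': "sup T1 A'' = A'" "mu f A' = mu f T1 + mu f A''"
    using quasi_modular_split[OF A'(4,1)] .
  obtain B'' where B'': "sup T2 B'' = B'" "mu f B' = mu f T2 + mu f B''"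
    using quasi_modular_split[OF B'(4,1)] .
  define T where "T = sup T2 T1"
  have TQ: "inf T Q = bot"
    unfolding T_def using T2(1) \<open>T2 \<le> P\<close> le(2) T1(1) by (rule inf_sup_disjoint)
  have UR: "inf (sup S T) R = bot"
    using S(1) \<open>S \<le> Q\<close> le(1) TQ by (rule inf_sup_disjoint)
  have T_le: "T \<le> inf A B" using T1_le T2_le by (simp add: T_def)
  have mu_U: "mu f (sup S T) \<le> mu f S + mu f T1 + mu f T2"
  proof -
    have "inf S T \<le> inf T Q" using \<open>S \<le> Q\<close> by (simp add: le_infI1)
    then have "inf S T = bot" using TQ by (simp add: bot_unique)
    moreover have "inf T2 T1 \<le> inf T1 P" using \<open>T2 \<le> P\<close> by (simp add: le_infI1)
    then have "inf T2 T1 = bot" using T1(1) by (simp add: bot_unique)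
    ultimately show ?thesis
      using mu_sup_le[of S T] mu_sup_le[of T2 T1] by (simp add: T_def)
  qed
  have "rho Z lam f (inf A B) \<le> lam m + mu f (sup S T)"
  proof (rule rho_le[OF m(1)])
    have "sup S T \<le> inf A B" using S_le T_le by simp
    then have "inf (sup S T) m = inf (sup S T) R"
      by (simp add: R_def inf.absorb1 flip: inf.assoc)
    then show "inf (sup S T) m = bot" using UR by simp
    have "sup (sup S T) R = sup T1 (sup T2 (sup S R))" by (simp add: T_def ac_simps)
    then show "sup (sup S T) (inf (inf A B) m) = inf A B"
      using S(2) T2(2) T1(2) by (simp flip: R_def)
  qed
  moreover have "lam m + lam j + mu f S \<le> lam z1 + lam z2"
  proof -
    have "inf S m = inf S R"
      using S_le by (simp add: R_def inf.absorb1 flip: inf.assoc)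
    then have "inf S m = bot" using S(1) by simp
    \<comment> \<open>With \<open>mc\<close> above \<open>S\<close> and \<open>S\<close> in place of
      \<open>A\<close>, the meet inside \<open>mu f\<close> in (Z2) collapses to
      \<open>S\<close>.\<close>
    then obtain mc where mc: "S \<le> mc" "inf mc m = bot" "sup mc m = top"
      by (rule exists_complement_above[of S m top]) auto
    then have "mc \<in> complements (meet_in Z z1 z2)" by (simp add: complements_def m_def)
    then have "lam m + lam j + mu f (inf (inf (inf S z1) z2) mc) \<le> lam z1 + lam z2"
      using Z2 z1(1) z2(1) unfolding axiom_Z2_def m_def j_def by blast
    then show ?thesis using S_le mc(1) by (simp add: inf.absorb1)
  qed
  moreover have "rho Z lam f (sup A B) \<le> lam j + (mu f A'' + mu f B'')"
  proof -
    let ?J = "inf (sup A B) j"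
    have J: "inf A z1 \<le> ?J" "inf B z2 \<le> ?J" "T2 \<le> ?J"
      using j T2_le by (auto intro: le_infI1 le_infI2 le_supI1 le_supI2 order_trans)
    define Y where "Y = sup ?J (sup A'' B'')"
    have Y: "?J \<le> Y" "A'' \<le> Y" "B'' \<le> Y" by (auto simp: Y_def intro: le_supI2)
    \<comment> \<open>The order matters: \<open>T2\<close> is below \<open>z1\<close>, hence below
      \<open>j\<close>, which yields \<open>B'\<close> and then \<open>B\<close>. Only then is
      \<open>T1\<close>, being below \<open>B\<close>, available for \<open>A'\<close> and
      \<open>A\<close>.\<close>
    have "B' \<le> Y" using B''(1) Y J(3) by (metis le_sup_iff order_trans)
    then have "B \<le> Y" using B'(2) Y(1) J(2) by (metis le_sup_iff order_trans)
    then have "A' \<le> Y" using A''(1) Y T1_le(2) by (metis le_sup_iff order_trans)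
    then have "A \<le> Y" using A'(2) Y(1) J(1) by (metis le_sup_iff order_trans)
    moreover have "A'' \<le> A" "B'' \<le> B"
      using A''(1) A'(2) B''(1) B'(2) by (metis le_sup_iff order_refl)+
    then have "Y \<le> sup A B" by (auto simp: Y_def intro: le_supI1 le_supI2)
    ultimately have "Y = sup A B" using \<open>B \<le> Y\<close> by (intro antisym) auto
    then obtain V where V: "inf V ?J = bot" "sup V ?J = sup A B" "mu f V \<le> mu f A'' + mu f B''"
      using exists_complement_mu_le[of ?J A'' B''] unfolding Y_def by blast
    have "inf V j = bot"
      using V by (metis inf.absorb1 inf.assoc sup.cobounded1)
    then show ?thesis using rho_le[OF j(1) _ V(2)] V(3) by simp
  qed
  \<comment> \<open>The weights of \<open>T1\<close> and \<open>T2\<close> lost in passing to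
    \<open>A''\<close> and \<open>B''\<close> are those spent on \<open>inf A B\<close>; the weight
    of \<open>S\<close> is covered by the (Z2) inequality.\<close>
  ultimately show ?thesis
    using mu_U A'(3) B'(3) A''(2) B''(2) by linarith
qed

end

end

end

end

end

section \<open>The polymatroid axioms for \<open>rho\<close>\<close>

theorem theorem5p10:
  fixes Z :: "'a::{finite, bounded_lattice} set"
    and lam f :: "'a \<Rightarrow> real"
  assumes "modular_lat TYPE('a)"
    and "complemented_lat TYPE('a)"
    and "inherited_lattice Z"
    and "\<And>z. z \<in> Z \<Longrightarrow> 0 \<le> lam z"
    and "\<And>a. atom a \<Longrightarrow> 0 \<le> f a"
    and "axiom_Z1 Z lam f"
    and "axiom_Z2 Z lam f"
    and "axiom_Z5 Z lam"
  shows "polymatroid (rho Z lam f)"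
  unfolding polymatroid_def
proof (intro exI[of _ "MAX a. \<bar>f a\<bar>"] conjI allI monoI)
  have "\<bar>f bot\<bar> \<le> (MAX a. \<bar>f a\<bar>)" by (rule Max_ge) auto
  then show "0 \<le> (MAX a. \<bar>f a\<bar>)" by linarith
next
  fix A show "0 \<le> rho Z lam f A"
    using assms(1,2,5,3,4) by (rule rho_nonneg)
next
  fix A show "rho Z lam f A \<le> (MAX a. \<bar>f a\<bar>) * real (height A)"
    using assms(1,2,5,3,4,8) by (rule rho_le_height)
next
  fix A B :: 'a assume "A \<le> B"
  with assms(1,2,5,3,4,6) show "rho Z lam f A \<le> rho Z lam f B" by (rule rho_mono)
next
  fix A B
  have "rho Z lam f (inf A B) + rho Z lam f (sup A B) \<le> rho Z lam f A + rho Z lam f B"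
    using assms(1,2,5,3,4,6,7) by (rule rho_submodular)
  then show "rho Z lam f A - rho Z lam f (inf A B) \<ge> rho Z lam f (sup A B) - rho Z lam f B"
    by linarith
qed

end
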